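(* Let $1\le p<\infty$, let $K$ be a compact Hausdorff space, let $X,Y$ be Banach spaces, and let $m\leftrightarrow T:C(K,X)\to Y$ be a strongly bounded operator. If $T$ is weak Dunford-Pettis (respectively weak$^*$ Dunford-Pettis, weak $p$-convergent, weak$^*$ $p$-convergent), then for each $A\in\Sigma$ the operator $m(A):X\to Y$ is weak Dunford-Pettis (respectively weak$^*$ Dunford-Pettis, weak $p$-convergent, weak$^*$ $p$-convergent).
   Context: Operator means bounded linear map. $C(K,X)$ is the space of continuous functions $K\to X$ with the sup norm; $\Sigma$ is the Borel $\sigma$-algebra of $K$. Its dual is $rcabv(\Sigma,X^* )$, the regular countably additive $X^*$-valued Borel measures of bounded variation. Every operator $T:C(K,X)\to Y$ has a representing measure $m:\Sigma\to L(X,Y^{**})$ (written $m\leftrightarrow T$), $m(A)x=T^{**}(\chi_A x)$, where $\chi_A x\in C(K,X)^{**}$ acts on $\mu\in rcabv(\Sigma,X^* )$ by $\langle \mu(A),x\rangle$; one has $T(f)=\int_K f\,dm$. For $y^*\in Y^*$ put $y^*m=T^*(y^* )\in rcabv(\Sigma,X^* )$, so $\langle y^*m(A),x\rangle=\langle m(A)x,y^*\rangle$. The semivariation is $\tilde m(E)=\sup\{|y^*m|(E): \|y^*\|\le 1\}$, with $|\cdot|$ denoting variation. $T$ (or $m$) is strongly bounded if $\tilde m(A_i)\to 0$ for every decreasing sequence $(A_i)$ in $\Sigma$ with empty intersection; in that case $m$ takes values in $L(X,Y)$. A sequence $(x_n)$ in a Banach space $E$ is weakly $p$-summable if $(x^*(x_n))\in\ell_p$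 for all $x^*\in E^*$. An operator $S:E\to F$ between Banach spaces is weak Dunford-Pettis (resp. weak$^*$ Dunford-Pettis) if $\langle S(x_n),y_n^*\rangle\to 0$ whenever $(x_n)$ is weakly null in $E$ and $(y_n^* )$ is weakly null (resp. $w^*$-null) in $F^*$; it is weak $p$-convergent (resp. weak$^*$ $p$-convergent) if $\langle S(x_n),y_n^*\rangle\to 0$ whenever $(x_n)$ is weakly $p$-summable in $E$ and $(y_n^* )$ is weakly null (resp. $w^*$-null) in $F^*$. *)

theory Defs
  imports "HOL-Analysis.Analysis"
begin

type_synonym 'a dual = "'a \<Rightarrow>\<^sub>L real"
type_synonym 'a bidual = "('a \<Rightarrow>\<^sub>L real) \<Rightarrow>\<^sub>L real"

lift_definition canonical_embedding :: "'a::real_normed_vector \<Rightarrow>\<^sub>L 'a bidual"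
  is "\<lambda>x. blinfun.prod_left x"
  by (rule blinfun.bounded_linear_prod_left)

lemma canonical_embedding_apply:
  "blinfun_apply (blinfun_apply canonical_embedding x) \<phi> = blinfun_apply \<phi> x"
  by transfer simp

lift_definition dual_map ::
  "('a::real_normed_vector \<Rightarrow>\<^sub>L 'b::real_normed_vector) \<Rightarrow> 'b dual \<Rightarrow>\<^sub>L 'a dual"
  is "\<lambda>T \<phi>. \<phi> o\<^sub>L T"
  by (rule bounded_bilinear.bounded_linear_left[OF bounded_bilinear_blinfun_compose])

lemma dual_map_apply:
  "blinfun_apply (blinfun_apply (dual_map T) \<phi>) x = blinfun_apply \<phi> (blinfun_apply T x)"
  by transfer simp

definition weakly_null :: "(nat \<Rightarrow> 'a::real_normed_vector) \<Rightarrow> bool" where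
  "weakly_null x \<longleftrightarrow> (\<forall>\<phi>::'a dual. (\<lambda>n. blinfun_apply \<phi> (x n)) \<longlonglongrightarrow> 0)"

definition weak_star_null :: "(nat \<Rightarrow> 'a::real_normed_vector dual) \<Rightarrow> bool" where
  "weak_star_null \<psi> \<longleftrightarrow> (\<forall>x. (\<lambda>n. blinfun_apply (\<psi> n) x) \<longlonglongrightarrow> 0)"

definition weakly_p_summable :: "real \<Rightarrow> (nat \<Rightarrow> 'a::real_normed_vector) \<Rightarrow> bool" where
  "weakly_p_summable p x \<longleftrightarrow>
     (\<forall>\<phi>::'a dual. summable (\<lambda>n. \<bar>blinfun_apply \<phi> (x n)\<bar> powr p))"

definition weak_Dunford_Pettis ::
  "('a::real_normed_vector \<Rightarrow>\<^sub>L 'b::real_normed_vector) \<Rightarrow> bool" where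
  "weak_Dunford_Pettis S \<longleftrightarrow>
     (\<forall>x \<psi>. weakly_null x \<longrightarrow> weakly_null \<psi> \<longrightarrow>
        (\<lambda>n. blinfun_apply (\<psi> n :: 'b dual) (blinfun_apply S (x n))) \<longlonglongrightarrow> 0)"

definition weak_star_Dunford_Pettis ::
  "('a::real_normed_vector \<Rightarrow>\<^sub>L 'b::real_normed_vector) \<Rightarrow> bool" where
  "weak_star_Dunford_Pettis S \<longleftrightarrow>
     (\<forall>x \<psi>. weakly_null x \<longrightarrow> weak_star_null \<psi> \<longrightarrow>
        (\<lambda>n. blinfun_apply (\<psi> n) (blinfun_apply S (x n))) \<longlonglongrightarrow> 0)"

definition weak_p_convergent ::
  "real \<Rightarrow> ('a::real_normed_vector \<Rightarrow>\<^sub>L 'b::real_normed_vector) \<Rightarrow> bool" where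
  "weak_p_convergent p S \<longleftrightarrow>
     (\<forall>x \<psi>. weakly_p_summable p x \<longrightarrow> weakly_null \<psi> \<longrightarrow>
        (\<lambda>n. blinfun_apply (\<psi> n :: 'b dual) (blinfun_apply S (x n))) \<longlonglongrightarrow> 0)"

definition weak_star_p_convergent ::
  "real \<Rightarrow> ('a::real_normed_vector \<Rightarrow>\<^sub>L 'b::real_normed_vector) \<Rightarrow> bool" where
  "weak_star_p_convergent p S \<longleftrightarrow>
     (\<forall>x \<psi>. weakly_p_summable p x \<longrightarrow> weak_star_null \<psi> \<longrightarrow>
        (\<lambda>n. blinfun_apply (\<psi> n) (blinfun_apply S (x n))) \<longlonglongrightarrow> 0)"

text \<open>Vector measures are total functions on sets of points; only their values on Borel sets
  are ever constrained or used.\<close>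

definition variation ::
  "('k::topological_space set \<Rightarrow> 'v::real_normed_vector) \<Rightarrow> 'k set \<Rightarrow> ennreal" where
  "variation \<mu> E =
     (SUP P\<in>{P. finite P \<and> P \<subseteq> sets borel \<and> partition_on E P}. \<Sum>B\<in>P. ennreal (norm (\<mu> B)))"

definition rcabv :: "('k::topological_space set \<Rightarrow> 'v::real_normed_vector) \<Rightarrow> bool" where
  "rcabv \<mu> \<longleftrightarrow>
     (\<forall>A. range A \<subseteq> sets borel \<longrightarrow> disjoint_family A \<longrightarrow> (\<lambda>n::nat. \<mu> (A n)) sums \<mu> (\<Union>n. A n)) \<and>
     variation \<mu> UNIV < \<infinity> \<and>
     (\<forall>A\<in>sets borel. \<forall>\<epsilon>>0. \<exists>C U. compact C \<and> open U \<and> C \<subseteq> A \<and> A \<subseteq> U \<and>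
        variation \<mu> (U - C) < ennreal \<epsilon>)"

definition simple_vm_integral ::
  "('k::topological_space set \<Rightarrow> 'x::real_normed_vector dual) \<Rightarrow> ('k \<Rightarrow> 'x) \<Rightarrow> real" where
  "simple_vm_integral \<mu> s = (\<Sum>x\<in>range s. blinfun_apply (\<mu> (s -` {x})) x)"

text \<open>The integral of a uniform limit of Borel simple functions. When the measure has bounded
  variation, the value does not depend on the approximating sequence.\<close>

definition has_vm_integral ::
  "('k::topological_space set \<Rightarrow> 'x::real_normed_vector dual) \<Rightarrow> ('k \<Rightarrow> 'x) \<Rightarrow> real \<Rightarrow> bool" where
  "has_vm_integral \<mu> f I \<longleftrightarrow>
     (\<exists>s. (\<forall>n. simple_function borel (s n)) \<and> uniform_limit UNIV s f sequentially \<and>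
          (\<lambda>n. simple_vm_integral \<mu> (s n)) \<longlonglongrightarrow> I)"

text \<open>The identification of the dual of the space of continuous functions with the regular measures
  of bounded variation. For compact Hausdorff \<open>'k\<close> every functional has exactly one such measure.\<close>

definition measure_of_functional ::
  "('k::topological_space set \<Rightarrow> 'x::real_normed_vector dual) \<Rightarrow> ('k \<Rightarrow>\<^sub>C 'x) dual \<Rightarrow> bool" where
  "measure_of_functional \<mu> \<phi> \<longleftrightarrow>
     rcabv \<mu> \<and> (\<forall>f. has_vm_integral \<mu> (apply_bcontfun f) (blinfun_apply \<phi> f))"

text \<open>\<open>ind A x\<close> is the element of the bidual that sends a functional, seen as a measure \<open>\<mu>\<close>,
  to the number \<open>\<mu> A x\<close>.\<close>

definition is_bidual_indicator ::
  "('k::topological_space set \<Rightarrow> 'x::real_normed_vector \<Rightarrow> ('k \<Rightarrow>\<^sub>C 'x) bidual) \<Rightarrow> bool" where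
  "is_bidual_indicator ind \<longleftrightarrow>
     (\<forall>\<phi>. \<exists>\<mu>. measure_of_functional \<mu> \<phi> \<and>
        (\<forall>A\<in>sets borel. \<forall>x. blinfun_apply (ind A x) \<phi> = blinfun_apply (\<mu> A) x))"

definition representing_measure ::
  "('k::topological_space set \<Rightarrow> 'x::real_normed_vector \<Rightarrow>\<^sub>L 'y::real_normed_vector bidual) \<Rightarrow>
   (('k \<Rightarrow>\<^sub>C 'x) \<Rightarrow>\<^sub>L 'y) \<Rightarrow> bool" where
  "representing_measure m T \<longleftrightarrow>
     (\<exists>ind. is_bidual_indicator ind \<and>
        (\<forall>A\<in>sets borel. \<forall>x.
           blinfun_apply (m A) x = blinfun_apply (dual_map (dual_map T)) (ind A x)))"

text \<open>The measure \<open>y\<^sup>*m\<close>, characterised by \<open>\<langle>y\<^sup>*m(A), x\<rangle> = \<langle>m(A)x, y\<^sup>*\<rangle>\<close>.\<close>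

definition functional_measure ::
  "'y::real_normed_vector dual \<Rightarrow> ('k set \<Rightarrow> 'x::real_normed_vector \<Rightarrow>\<^sub>L 'y bidual) \<Rightarrow>
   'k set \<Rightarrow> 'x dual" where
  "functional_measure \<psi> m A = blinfun_apply canonical_embedding \<psi> o\<^sub>L m A"

lemma functional_measure_apply:
  "blinfun_apply (functional_measure \<psi> m A) x = blinfun_apply (blinfun_apply (m A) x) \<psi>"
  by (simp add: functional_measure_def canonical_embedding_apply)

definition semivariation ::
  "('k::topological_space set \<Rightarrow> 'x::real_normed_vector \<Rightarrow>\<^sub>L 'y::real_normed_vector bidual) \<Rightarrow>
   'k set \<Rightarrow> ennreal" where
  "semivariation m E = (SUP \<psi>\<in>{\<psi>. norm \<psi> \<le> 1}. variation (functional_measure \<psi> m) E)"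

definition strongly_bounded ::
  "('k::topological_space set \<Rightarrow> 'x::real_normed_vector \<Rightarrow>\<^sub>L 'y::real_normed_vector bidual) \<Rightarrow> bool"
where
  "strongly_bounded m \<longleftrightarrow>
     (\<forall>A. range A \<subseteq> sets borel \<longrightarrow> decseq A \<longrightarrow> (\<Inter>n. A n) = {} \<longrightarrow>
        (\<lambda>n::nat. semivariation m (A n)) \<longlonglongrightarrow> 0)"

end

theory Submission
  imports Defs
begin

text \<open>Strong boundedness makes the measures \<open>y\<^sup>*m\<close> with \<open>y\<^sup>*\<close> in the unit ball uniformly regular, so for
  every Borel set \<open>A\<close> and every \<open>e > 0\<close> there are compact sets \<open>C \<subseteq> A\<close> and \<open>D \<subseteq> - A\<close> such that the
  semivariation of what they leave out is at most \<open>e\<close>. A Urysohn function \<open>f\<close> separating \<open>C\<close> and \<open>D\<close>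
  then satisfies \<open>\<parallel>T(f x) - m(A)x\<parallel> \<le> e \<parallel>x\<parallel>\<close>. Hence \<open>m(A)\<close> is the limit in operator norm of the operators
  \<open>x \<mapsto> T(f x)\<close>; since \<open>Y\<close> is complete and closed in its bidual, \<open>m(A)\<close> takes values in \<open>Y\<close>. Each
  \<open>x \<mapsto> T(f x)\<close> inherits the four properties from \<open>T\<close>, and they pass to norm limits because weakly
  null and weak* null sequences are bounded.\<close>

section \<open>Norming functionals\<close>

definition sublinear :: "('a::real_vector \<Rightarrow> real) \<Rightarrow> bool" where
  "sublinear p \<longleftrightarrow>
     (\<forall>x y. p (x + y) \<le> p x + p y) \<and> (\<forall>c x. 0 \<le> c \<longrightarrow> p (c *\<^sub>R x) = c * p x)"

text \<open>One inequality suffices for positive \<open>c\<close>: applied with \<open>1 / c\<close>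
  to the vector \<open>c *\<^sub>R x\<close>, it yields the reverse one.\<close>

lemma sublinearI:
  assumes "\<And>x y. p (x + y) \<le> p x + p y"
    and zero: "p 0 = 0"
    and scale: "\<And>c x. 0 < c \<Longrightarrow> p (c *\<^sub>R x) \<le> c * p x"
  shows "sublinear p"
  unfolding sublinear_def
proof (intro conjI allI impI)
  fix c :: real and x
  assume "0 \<le> c"
  show "p (c *\<^sub>R x) = c * p x"
  proof (cases "c = 0")
    case False
    with \<open>0 \<le> c\<close> have c: "0 < c" by simp
    have "p ((1 / c) *\<^sub>R (c *\<^sub>R x)) \<le> (1 / c) * p (c *\<^sub>R x)"
      using c by (intro scale) simp
    then have "c * p x \<le> p (c *\<^sub>R x)"
      using c by (simp add: field_simps)
    then show ?thesis using scale[OF c, of x] by simp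
  qed (simp add: zero)
qed (fact assms(1))

lemma sublinear_add: "sublinear p \<Longrightarrow> p (x + y) \<le> p x + p y"
  and sublinear_scaleR: "sublinear p \<Longrightarrow> 0 \<le> c \<Longrightarrow> p (c *\<^sub>R x) = c * p x"
  by (simp_all add: sublinear_def)

lemma sublinear_zero: "sublinear p \<Longrightarrow> p 0 = 0"
  using sublinear_scaleR[of p 0] by simp

lemma sublinear_neg: "sublinear p \<Longrightarrow> - p (- x) \<le> p x"
  using sublinear_add[of p x "- x"] by (simp add: sublinear_zero)

lemma sublinear_norm: "sublinear norm"
  by (rule sublinearI) (auto intro: norm_triangle_ineq)

text \<open>The largest sublinear minorant of \<open>p\<close> with value \<open>- p y\<close> at \<open>- y\<close>.\<close>

definition directional_minorant :: "('a::real_vector \<Rightarrow> real) \<Rightarrow> 'a \<Rightarrow> 'a \<Rightarrow> real" where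
  "directional_minorant p y x = (INF t\<in>{0..}. p (x + t *\<^sub>R y) - t * p y)"

context
  fixes p :: "'a::real_vector \<Rightarrow> real"
  assumes p: "sublinear p"
begin

lemma directional_minorant_le:
  assumes "0 \<le> t"
  shows "directional_minorant p y x \<le> p (x + t *\<^sub>R y) - t * p y"
  unfolding directional_minorant_def
proof (rule cINF_lower)
  \<comment> \<open>A lower bound independent of \<open>t\<close> is what makes the real infimum in
    \<open>directional_minorant\<close> meaningful.\<close>
  have "- p (- x) \<le> p (x + t *\<^sub>R y) - t * p y" if "0 \<le> t" for t
    using sublinear_add[OF p, of "x + t *\<^sub>R y" "- x"] sublinear_scaleR[OF p that, of y] by simp
  then show "bdd_below ((\<lambda>t. p (x + t *\<^sub>R y) - t * p y) ` {0..})"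
    by (auto intro!: bdd_belowI2)
qed (use assms in simp)

lemma directional_minorant_greatest:
  assumes "\<And>t. 0 \<le> t \<Longrightarrow> b \<le> p (x + t *\<^sub>R y) - t * p y"
  shows "b \<le> directional_minorant p y x"
  unfolding directional_minorant_def by (rule cINF_greatest) (use assms in auto)

text \<open>Parameters add: \<open>t\<close> for \<open>x\<close> and \<open>t'\<close> for
  \<open>x'\<close> give \<open>t + t'\<close> for \<open>x + x'\<close>, and passing to the two
  infima one after the other yields subadditivity. For homogeneity, \<open>t\<close> for
  \<open>x\<close> corresponds to \<open>c * t\<close> for \<open>c *\<^sub>R x\<close>.\<close>

lemma sublinear_directional_minorant: "sublinear (directional_minorant p y)"
proof (rule sublinearI)
  let ?q = "directional_minorant p y"
  show "?q 0 = 0"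
  proof (rule antisym)
    show "?q 0 \<le> 0" using directional_minorant_le[of 0 y 0] sublinear_zero[OF p] by simp
    show "0 \<le> ?q 0"
      by (rule directional_minorant_greatest) (simp add: sublinear_scaleR[OF p])
  qed
  show "?q (x + x') \<le> ?q x + ?q x'" for x x'
  proof -
    have "?q (x + x') \<le> (p (x + t *\<^sub>R y) - t * p y) + (p (x' + t' *\<^sub>R y) - t' * p y)"
      if "0 \<le> t" "0 \<le> t'" for t t'
    proof -
      have "?q (x + x') \<le> p ((x + x') + (t + t') *\<^sub>R y) - (t + t') * p y"
        using that by (intro directional_minorant_le) simp
      also have "(x + x') + (t + t') *\<^sub>R y = (x + t *\<^sub>R y) + (x' + t' *\<^sub>R y)"
        by (simp add: algebra_simps)
      finally show ?thesis
        using sublinear_add[OF p, of "x + t *\<^sub>R y" "x' + t' *\<^sub>R y"] by (simp add: algebra_simps)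
    qed
    then have "?q (x + x') - (p (x + t *\<^sub>R y) - t * p y) \<le> ?q x'" if "0 \<le> t" for t
      using that by (intro directional_minorant_greatest) (smt (verit))
    then have "?q (x + x') - ?q x' \<le> ?q x"
      by (intro directional_minorant_greatest) (smt (verit))
    then show ?thesis by simp
  qed
  show "?q (c *\<^sub>R x) \<le> c * ?q x" if c: "0 < c" for c x
  proof -
    have "?q (c *\<^sub>R x) / c \<le> ?q x"
    proof (rule directional_minorant_greatest)
      fix t :: real assume "0 \<le> t"
      then have "?q (c *\<^sub>R x) \<le> p (c *\<^sub>R x + (c * t) *\<^sub>R y) - (c * t) * p y"
        using c by (intro directional_minorant_le) simp
      also have "p (c *\<^sub>R x + (c * t) *\<^sub>R y) = c * p (x + t *\<^sub>R y)"
        using sublinear_scaleR[OF p, of c "x + t *\<^sub>R y"] c by (simp add: scaleR_add_right)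
      finally show "?q (c *\<^sub>R x) / c \<le> p (x + t *\<^sub>R y) - t * p y"
        using c by (simp add: field_simps)
    qed
    then show ?thesis using c by (simp add: field_simps)
  qed
qed

lemma directional_minorant_le_self: "directional_minorant p y \<le> p"
  using directional_minorant_le[of 0 y] by (simp add: le_fun_def)

end

text \<open>Zorn's lemma is applied to the reversed pointwise order. A nonempty chain has its
  pointwise infimum as a lower bound; the infimum is finite because every sublinear \<open>q\<close>
  below \<open>p\<close> satisfies \<open>q x \<ge> - q (- x) \<ge> - p (- x)\<close>.\<close>

lemma minimal_sublinear_exists:
  assumes p: "sublinear p"
  obtains m where "sublinear m" "m \<le> p" "\<And>q. sublinear q \<Longrightarrow> q \<le> m \<Longrightarrow> q = m"
proof -
  define A where "A = {q. sublinear q \<and> q \<le> p}"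
  let ?P = "\<lambda>q r :: 'a \<Rightarrow> real. r \<le> q"
  have "\<exists>m\<in>A. \<forall>a\<in>A. ?P m a \<longrightarrow> a = m"
  proof (rule predicate_Zorn)
    show "partial_order_on A (relation_of ?P A)"
      by (rule partial_order_on_relation_ofI) auto
    fix C assume "C \<in> Chains (relation_of ?P A)"
    then have sub: "C \<subseteq> A" and chain: "\<And>q r. q \<in> C \<Longrightarrow> r \<in> C \<Longrightarrow> q \<le> r \<or> r \<le> q"
      by (auto simp: Chains_def relation_of_def)
    show "\<exists>u\<in>A. \<forall>a\<in>C. u \<le> a"
    proof (cases "C = {}")
      case True
      then show ?thesis using p by (auto simp: A_def)
    next
      case False
      define u where "u x = (INF q\<in>C. q x)" for x
      have CD: "sublinear q" "q x \<le> p x" if "q \<in> C" for q x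
        using that sub by (auto simp: A_def le_fun_def)
      have "- p (- x) \<le> q x" if "q \<in> C" for q x
        using sublinear_neg[OF CD(1)[OF that], of x] CD(2)[OF that, of "- x"] by linarith
      then have lower: "u x \<le> q x" if "q \<in> C" for q x
        unfolding u_def using that by (intro cINF_lower bdd_belowI2) auto
      have greatest: "b \<le> u x" if "\<And>q. q \<in> C \<Longrightarrow> b \<le> q x" for b x
        unfolding u_def using False that by (intro cINF_greatest) auto
      have "sublinear u"
      proof (rule sublinearI)
        show "u 0 = 0"
          unfolding u_def using False CD(1) by (simp add: sublinear_zero cong: INF_cong_simp)
        show "u (x + y) \<le> u x + u y" for x y
        proof -
          \<comment> \<open>The smaller of two members of the chain serves for both arguments, so
            the infima over \<open>q\<close> and \<open>r\<close> can be taken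
            independently.\<close>
          have "u (x + y) \<le> q x + r y" if qr: "q \<in> C" "r \<in> C" for q r
          proof -
            obtain s where s: "s \<in> C" "s \<le> q" "s \<le> r" using chain[OF qr] qr by blast
            have "u (x + y) \<le> s x + s y"
              using lower[OF s(1)] sublinear_add[OF CD(1)[OF s(1)]] order_trans by blast
            then show ?thesis using s(2,3) by (smt (verit) le_fun_def)
          qed
          then have "u (x + y) - q x \<le> u y" if "q \<in> C" for q
            using that by (intro greatest) (smt (verit))
          then have "u (x + y) - u y \<le> u x"
            by (intro greatest) (smt (verit))
          then show ?thesis by simp
        qed
        show "u (c *\<^sub>R x) \<le> c * u x" if c: "0 < c" for c x
        proof -
          have "u (c *\<^sub>R x) / c \<le> u x"
          proof (rule greatest)
            fix q assume q: "q \<in> C"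
            have "u (c *\<^sub>R x) \<le> c * q x"
              using lower[OF q, of "c *\<^sub>R x"] sublinear_scaleR[OF CD(1)[OF q], of c x] c by simp
            then show "u (c *\<^sub>R x) / c \<le> q x" using c by (simp add: field_simps)
          qed
          then show ?thesis using c by (simp add: field_simps)
        qed
      qed
      moreover have "u \<le> p"
        using False lower CD(2) by (meson all_not_in_conv le_funI order_trans)
      ultimately show ?thesis using lower by (auto simp: A_def le_fun_def)
    qed
  qed
  then obtain m where "m \<in> A" "\<And>a. a \<in> A \<Longrightarrow> a \<le> m \<Longrightarrow> a = m" by blast
  then show thesis by (intro that[of m]) (auto simp: A_def)
qed

text \<open>Minimality forces \<open>m\<close> to equal its directional minorant in every direction
  \<open>y\<close>. The choice \<open>t = 1\<close> in that infimum gives superadditivity, so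
  \<open>m\<close> is additive.\<close>

lemma minimal_sublinear_linear:
  assumes m: "sublinear m" and min: "\<And>q. sublinear q \<Longrightarrow> q \<le> m \<Longrightarrow> q = m"
  shows "linear m"
proof -
  have "m x + m y \<le> m (x + y)" for x y
    using directional_minorant_le[OF m, of 1 y x]
      min[OF sublinear_directional_minorant[OF m] directional_minorant_le_self[OF m], of y] by simp
  then have add: "m (x + y) = m x + m y" for x y
    using sublinear_add[OF m, of x y] by (meson antisym)
  have neg: "m (- x) = - m x" for x
    using add[of x "- x"] sublinear_zero[OF m] by simp
  have "m (c *\<^sub>R x) = c * m x" for c x
    using sublinear_scaleR[OF m, of c x] sublinear_scaleR[OF m, of "- c" x] neg[of "c *\<^sub>R x"]
    by (cases "0 \<le> c") auto
  with add show ?thesis by (intro linearI) auto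
qed

text \<open>This is the Hahn-Banach consequence used below. A minimal sublinear functional under the
  directional minorant of the norm is linear and dominated by the norm; its value at
  \<open>- y\<close> is at most \<open>- norm y\<close>, which forces equality at
  \<open>y\<close>.\<close>

lemma norming_functional_exists:
  fixes y :: "'a::real_normed_vector"
  obtains \<phi> :: "'a dual" where "norm \<phi> \<le> 1" "\<phi> y = norm y"
proof -
  let ?q = "directional_minorant norm y"
  obtain m where m: "sublinear m" "m \<le> ?q" "\<And>q. sublinear q \<Longrightarrow> q \<le> m \<Longrightarrow> q = m"
    using minimal_sublinear_exists[OF sublinear_directional_minorant[OF sublinear_norm]] by blast
  have "linear m" by (rule minimal_sublinear_linear) (use m in auto)
  have le: "m x \<le> norm x" for x
    using m(2) directional_minorant_le_self[OF sublinear_norm, of y]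
    by (meson le_fun_def order_trans)
  have abs_le: "\<bar>m x\<bar> \<le> norm x" for x
    using le[of x] le[of "- x"] linear_neg[OF \<open>linear m\<close>, of x] by simp
  have "?q (- y) \<le> - norm y"
    using directional_minorant_le[OF sublinear_norm, of 1 y "- y"] by simp
  then have "m (- y) \<le> - norm y"
    using m(2) by (meson le_fun_def order_trans)
  with le[of y] have my: "m y = norm y"
    using linear_neg[OF \<open>linear m\<close>, of y] by simp
  have bl: "bounded_linear m"
    using \<open>linear m\<close> abs_le
    by (intro bounded_linear_intro[where K = 1]) (auto simp: linear_add linear_cmul)
  show thesis
  proof (rule that[of "Blinfun m"])
    show "norm (Blinfun m) \<le> 1"
      by (rule norm_blinfun_bound) (use abs_le in \<open>auto simp: bounded_linear_Blinfun_apply[OF bl]\<close>)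
  qed (simp add: bounded_linear_Blinfun_apply[OF bl] my)
qed

section \<open>The isometric embedding into the bidual\<close>

lemma norm_canonical_embedding: "norm (canonical_embedding x) = norm x"
proof (rule antisym)
  show "norm (canonical_embedding x) \<le> norm x"
  proof (rule norm_blinfun_bound)
    show "norm (canonical_embedding x \<phi>) \<le> norm x * norm \<phi>" for \<phi>
      using norm_blinfun[of \<phi> x] by (simp add: canonical_embedding_apply mult.commute)
  qed simp
  obtain \<phi> :: "'a dual" where \<phi>: "norm \<phi> \<le> 1" "\<phi> x = norm x"
    by (rule norming_functional_exists)
  have "norm x = norm (canonical_embedding x \<phi>)"
    by (simp add: canonical_embedding_apply \<phi>)
  also have "\<dots> \<le> norm (canonical_embedding x) * norm \<phi>" by (rule norm_blinfun)
  also have "\<dots> \<le> norm (canonical_embedding x)" using \<phi> by (simp add: mult_left_le)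
  finally show "norm x \<le> norm (canonical_embedding x)" .
qed

lemma norm_canonical_embedding_compose:
  "norm (canonical_embedding o\<^sub>L S) = norm S"
proof (rule antisym)
  show "norm (canonical_embedding o\<^sub>L S) \<le> norm S"
    by (rule norm_blinfun_bound) (simp_all add: norm_canonical_embedding norm_blinfun)
  show "norm S \<le> norm (canonical_embedding o\<^sub>L S)"
  proof (rule norm_blinfun_bound)
    show "norm (S x) \<le> norm (canonical_embedding o\<^sub>L S) * norm x" for x
      using norm_blinfun[of "canonical_embedding o\<^sub>L S" x] by (simp add: norm_canonical_embedding)
  qed simp
qed

section \<open>Boundedness of weakly null sequences\<close>

text \<open>If all the open sets \<open>W k\<close> were dense, Baire's theorem would give a point
  in all of them, where the sequence is unbounded. So some \<open>W k\<close> misses a ball, on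
  which every \<open>F n\<close> is bounded by \<open>k\<close>, and linearity spreads this bound to
  the whole space.\<close>

theorem uniform_boundedness:
  fixes F :: "nat \<Rightarrow> 'a::banach \<Rightarrow>\<^sub>L 'b::real_normed_vector"
  assumes bdd: "\<And>x. Bseq (\<lambda>n. F n x)"
  obtains B where "\<And>n. norm (F n) \<le> B"
proof -
  define W where "W k = {x. \<exists>n. real k < norm (F n x)}" for k
  have W_open: "open (W k)" for k
  proof -
    have "W k = (\<Union>n. {x. real k < norm (F n x)})" by (auto simp: W_def)
    moreover have "open {x. real k < norm (F n x)}" for n
      by (intro open_Collect_less continuous_intros)
    ultimately show ?thesis by auto
  qed
  have "\<exists>k. closure (W k) \<noteq> UNIV"
  proof (rule ccontr)
    assume "\<not> ?thesis"
    then have dense: "closure (W k) = UNIV" for k by blast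
    have "euclidean closure_of \<Inter>(range W) = (UNIV :: 'a set)"
      using Met_TC.metric_Baire_category[of "range W"] W_open dense
      by (simp add: complete_UNIV) blast
    then have "\<Inter>(range W) \<noteq> {}" by (metis closure_of_empty UNIV_not_empty)
    then obtain x where "x \<in> \<Inter>(range W)" by blast
    obtain K where K: "\<And>n. norm (F n x) \<le> K"
      using bdd[of x] by (auto simp: Bseq_def)
    obtain k :: nat where "K \<le> real k" using real_arch_simple by blast
    moreover obtain n where "real k < norm (F n x)"
      using \<open>x \<in> \<Inter>(range W)\<close> by (auto simp: W_def)
    ultimately show False using K[of n] by simp
  qed
  then obtain k a where "a \<notin> closure (W k)" by blast
  then obtain e where e: "0 < e" "ball a e \<inter> W k = {}"
    using open_contains_ball_eq[OF open_Compl[OF closed_closure], of a "W k"] closure_subset[of "W k"]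
    by blast
  have small: "norm (F n x) \<le> real k" if "dist a x < e" for n x
  proof -
    have "x \<notin> W k" using e(2) that by auto
    then show ?thesis by (simp add: W_def not_less)
  qed
  have "norm (F n) \<le> 4 * real k / e" for n
  proof (rule norm_blinfun_bound)
    fix x
    show "norm (F n x) \<le> 4 * real k / e * norm x"
    proof (cases "x = 0")
      case False
      \<comment> \<open>The vector \<open>c *\<^sub>R x\<close> has norm \<open>e / 2\<close>, so
        \<open>a + c *\<^sub>R x\<close> stays in the ball. Its image under \<open>F n\<close> is a
        difference of two values of norm at most \<open>k\<close>; dividing \<open>2 * k\<close> by
        \<open>c\<close> produces the factor \<open>4 * k / e\<close>.\<close>
      define c where "c = e / (2 * norm x)"
      have c: "0 < c" using e(1) False by (simp add: c_def)
      have "c * norm x = e / 2" using False by (simp add: c_def)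
      then have "dist a (a + c *\<^sub>R x) < e" using e(1) c by (simp add: dist_norm)
      then have "norm (F n (a + c *\<^sub>R x)) \<le> real k" "norm (F n a) \<le> real k"
        using small e(1) by auto
      then have "norm (F n (c *\<^sub>R x)) \<le> 2 * real k"
        using norm_triangle_ineq4[of "F n (a + c *\<^sub>R x)" "F n a"] by (simp add: blinfun.add_right)
      then have "c * norm (F n x) \<le> 2 * real k" using c by (simp add: blinfun.scaleR_right)
      then have "norm (F n x) \<le> 2 * real k / c" using c by (simp add: field_simps)
      also have "\<dots> = 4 * real k / e * norm x" by (simp add: c_def)
      finally show ?thesis .
    qed simp
  qed (use e in simp)
  then show thesis by (rule that)
qed

lemma weak_star_null_bounded:
  fixes \<psi> :: "nat \<Rightarrow> 'a::banach dual"
  assumes "weak_star_null \<psi>"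
  obtains B where "\<And>n. norm (\<psi> n) \<le> B"
proof (rule uniform_boundedness)
  show "Bseq (\<lambda>n. \<psi> n x)" for x
    using assms by (intro convergent_imp_Bseq convergentI[of _ 0]) (simp add: weak_star_null_def)
qed (use that in blast)

lemma weakly_null_imp_weak_star_null:
  assumes "weakly_null \<psi>"
  shows "weak_star_null \<psi>"
  unfolding weak_star_null_def
proof
  fix x
  show "(\<lambda>n. \<psi> n x) \<longlonglongrightarrow> 0"
    using assms[unfolded weakly_null_def, rule_format, of "canonical_embedding x"]
    by (simp add: canonical_embedding_apply)
qed

text \<open>Viewed in the bidual, the sequence consists of functionals on the dual, which is
  complete whether or not the space itself is. Uniform boundedness applies there, and the isometry
  carries the bound back.\<close>

lemma weakly_null_bounded:
  fixes x :: "nat \<Rightarrow> 'a::real_normed_vector"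
  assumes "weakly_null x"
  obtains B where "\<And>n. norm (x n) \<le> B"
proof (rule weak_star_null_bounded[of "\<lambda>n. canonical_embedding (x n)"])
  show "weak_star_null (\<lambda>n. canonical_embedding (x n))"
    using assms by (simp add: weak_star_null_def weakly_null_def canonical_embedding_apply)
qed (use that in \<open>auto simp: norm_canonical_embedding\<close>)

text \<open>The terms of a convergent series tend to zero, and so do their \<open>p\<close>-th
  roots. This supplies the norm bound needed for the two \<open>p\<close>-convergent
  properties.\<close>

lemma weakly_p_summable_imp_weakly_null:
  assumes "0 < p" "weakly_p_summable p x"
  shows "weakly_null x"
  unfolding weakly_null_def
proof
  fix \<phi> :: "'a dual"
  have "(\<lambda>n. \<bar>\<phi> (x n)\<bar> powr p) \<longlonglongrightarrow> 0"
    using assms(2) by (auto simp: weakly_p_summable_def intro: summable_LIMSEQ_zero)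
  then have "(\<lambda>n. (\<bar>\<phi> (x n)\<bar> powr p) powr (1 / p)) \<longlonglongrightarrow> 0 powr (1 / p)"
    by (rule tendsto_powr') (use assms(1) in auto)
  then show "(\<lambda>n. \<phi> (x n)) \<longlonglongrightarrow> 0"
    using assms(1) by (simp add: powr_powr tendsto_rabs_zero_iff)
qed

section \<open>Images of null sequences and norm limits of operators\<close>

lemma weakly_null_blinfun:
  assumes "weakly_null x"
  shows "weakly_null (\<lambda>n. blinfun_apply M (x n))"
  unfolding weakly_null_def
proof
  fix \<phi> :: "'b dual"
  show "(\<lambda>n. \<phi> (M (x n))) \<longlonglongrightarrow> 0"
    using assms[unfolded weakly_null_def, rule_format, of "\<phi> o\<^sub>L M"] by simp
qed

lemma weakly_p_summable_blinfun:
  assumes "weakly_p_summable p x"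
  shows "weakly_p_summable p (\<lambda>n. blinfun_apply M (x n))"
  unfolding weakly_p_summable_def
proof
  fix \<phi> :: "'b dual"
  show "summable (\<lambda>n. \<bar>\<phi> (M (x n))\<bar> powr p)"
    using assms[unfolded weakly_p_summable_def, rule_format, of "\<phi> o\<^sub>L M"] by simp
qed

text \<open>Replacing \<open>S\<close> by \<open>R\<close> changes the pairing by at most
  \<open>C * norm (S - R) * B\<close>, uniformly in \<open>n\<close>.\<close>

lemma pairing_tendsto_zero_closed:
  fixes x :: "nat \<Rightarrow> 'a::real_normed_vector" and \<psi> :: "nat \<Rightarrow> 'b::real_normed_vector dual"
  assumes x: "\<And>n. norm (x n) \<le> B" and \<psi>: "\<And>n. norm (\<psi> n) \<le> C"
    and approx: "\<And>e. 0 < e \<Longrightarrow> \<exists>R. norm (S - R) \<le> e \<and> (\<lambda>n. \<psi> n (blinfun_apply R (x n))) \<longlonglongrightarrow> 0"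
  shows "(\<lambda>n. \<psi> n (blinfun_apply S (x n))) \<longlonglongrightarrow> 0"
proof (rule LIMSEQ_I)
  fix e :: real assume e: "0 < e"
  have BC: "0 \<le> B" "0 \<le> C" using x \<psi> norm_ge_zero order_trans by blast+
  \<comment> \<open>The summand 1 keeps the denominator positive when \<open>B * C = 0\<close>; the
    factor 2 leaves half of \<open>e\<close> for the pairing with \<open>R\<close>.\<close>
  define d where "d = e / (2 * (B * C + 1))"
  have d: "0 < d" using e BC by (simp add: d_def add_nonneg_pos)
  have "C * (d * B) \<le> d * (B * C + 1)" using d by (simp add: algebra_simps)
  also have "\<dots> = e / 2" using BC by (simp add: d_def field_simps add_nonneg_pos add_nonneg_eq_0_iff)
  finally have dBC: "C * (d * B) \<le> e / 2" .
  obtain R where R: "norm (S - R) \<le> d" "(\<lambda>n. \<psi> n (R (x n))) \<longlonglongrightarrow> 0" using approx[OF d] by blast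
  obtain N where N: "\<And>n. N \<le> n \<Longrightarrow> norm (\<psi> n (R (x n))) < e / 2"
    using LIMSEQ_D[OF R(2), of "e / 2"] e by auto
  have "norm (\<psi> n (S (x n)) - 0) < e" if "N \<le> n" for n
  proof -
    have "norm (\<psi> n ((S - R) (x n))) \<le> norm (\<psi> n) * norm ((S - R) (x n))" by (rule norm_blinfun)
    also have "\<dots> \<le> C * (d * B)"
    proof (rule mult_mono)
      show "norm ((S - R) (x n)) \<le> d * B"
        using norm_blinfun[of "S - R" "x n"] mult_mono[OF R(1) x[of n]] d by simp
    qed (use \<psi> BC in auto)
    finally have "norm (\<psi> n ((S - R) (x n))) \<le> e / 2" using dBC by simp
    then show ?thesis
      using N[OF that] norm_triangle_sub[of "\<psi> n (S (x n))" "\<psi> n (R (x n))"]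
      by (simp add: blinfun.diff_left blinfun.diff_right)
  qed
  then show "\<exists>N. \<forall>n\<ge>N. norm (\<psi> n (S (x n)) - 0) < e" by blast
qed

section \<open>Vector measures of bounded variation\<close>

text \<open>Set functions are total, so two of them that stand for the same measure may differ off
  the Borel sets. This lemma and the next two make that difference harmless.\<close>

lemma variation_cong:
  assumes "\<And>B. B \<in> sets borel \<Longrightarrow> \<mu> B = \<nu> B"
  shows "variation \<mu> E = variation \<nu> E"
  unfolding variation_def by (intro SUP_cong refl sum.cong) (use assms in auto)

lemma rcabv_cong:
  assumes "\<And>B. B \<in> sets borel \<Longrightarrow> \<mu> B = \<nu> B"
  shows "rcabv \<mu> \<longleftrightarrow> rcabv \<nu>"
proof -
  have "(\<lambda>n. \<mu> (A n)) = (\<lambda>n. \<nu> (A n)) \<and> \<mu> (\<Union>n. A n) = \<nu> (\<Union>n. A n)"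
    if "range A \<subseteq> sets borel" for A :: "nat \<Rightarrow> 'a set"
    using that by (auto intro!: assms)
  then show ?thesis
    by (simp add: rcabv_def variation_cong[OF assms] cong: imp_cong)
qed

lemma has_vm_integral_cong:
  assumes "\<And>B. B \<in> sets borel \<Longrightarrow> \<mu> B = \<nu> B"
  shows "has_vm_integral \<mu> f I \<longleftrightarrow> has_vm_integral \<nu> f I"
proof -
  have eq: "simple_vm_integral \<mu> s = simple_vm_integral \<nu> s" if "simple_function borel s" for s
    unfolding simple_vm_integral_def
    using simple_functionD(2)[OF that] by (intro sum.cong refl) (simp add: assms)
  show ?thesis
    unfolding has_vm_integral_def by (intro ex_cong1 conj_cong refl) (simp add: eq)
qed

section \<open>Finite additivity and estimates of the variation\<close>

lemma rcabv_empty: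
  assumes "rcabv \<mu>"
  shows "\<mu> {} = 0"
proof -
  \<comment> \<open>Countable additivity on a sequence of empty sets makes a constant series
    converge, so the constant is zero.\<close>
  have "(\<lambda>n::nat. \<mu> {}) sums \<mu> {}"
    using assms[unfolded rcabv_def, THEN conjunct1, rule_format, of "\<lambda>_. {}"]
    by (simp add: disjoint_family_on_def)
  then have "(\<lambda>n::nat. \<mu> {}) \<longlonglongrightarrow> 0"
    by (intro summable_LIMSEQ_zero sums_summable)
  then show ?thesis by (simp add: LIMSEQ_const_iff)
qed

lemma rcabv_Un:
  assumes "rcabv \<mu>" "A \<in> sets borel" "B \<in> sets borel" "A \<inter> B = {}"
  shows "\<mu> (A \<union> B) = \<mu> A + \<mu> B"
proof -
  have "range (binaryset A B) \<subseteq> sets borel" "disjoint_family (binaryset A B)"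
    using assms(2-4) by (auto simp: range_binaryset_eq disjoint_family_on_def binaryset_def)
  then have "(\<lambda>n. \<mu> (binaryset A B n)) sums \<mu> (A \<union> B)"
    using assms(1)[unfolded rcabv_def, THEN conjunct1, rule_format, of "binaryset A B"]
    by (simp add: UN_binaryset_eq)
  then show ?thesis
    using binaryset_sums[of \<mu>, OF rcabv_empty[OF assms(1)]] sums_unique2 by blast
qed

lemma rcabv_UN:
  assumes "rcabv \<mu>" "finite I" "\<And>i. i \<in> I \<Longrightarrow> B i \<in> sets borel" "disjoint_family_on B I"
  shows "\<mu> (\<Union>i\<in>I. B i) = (\<Sum>i\<in>I. \<mu> (B i))"
  using assms(2-4)
proof (induction I rule: finite_induct)
  case (insert i I)
  have "\<mu> (B i \<union> (\<Union>j\<in>I. B j)) = \<mu> (B i) + \<mu> (\<Union>j\<in>I. B j)"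
  proof (rule rcabv_Un[OF assms(1)])
    show "(\<Union>j\<in>I. B j) \<in> sets borel"
      using insert.prems(1) insert.hyps(1) by (intro sets.finite_UN) blast+
    have "B i \<inter> B j = {}" if "j \<in> I" for j
      using disjoint_family_onD[OF insert.prems(2), of i j] that insert.hyps(2) by blast
    then show "B i \<inter> (\<Union>j\<in>I. B j) = {}" by blast
  qed (simp add: insert.prems(1))
  moreover have "\<mu> (\<Union>j\<in>I. B j) = (\<Sum>j\<in>I. \<mu> (B j))"
    using insert.prems by (intro insert.IH) (auto intro: disjoint_family_on_mono)
  ultimately show ?case
    using insert.hyps by simp
qed (simp add: rcabv_empty[OF assms(1)])

text \<open>The variation ranges over partitions of \<open>E\<close> into nonempty blocks, whereas
  this family may have empty members and need not cover \<open>E\<close>. Empty members contribute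
  nothing and are dropped, which makes \<open>B\<close> injective; the uncovered rest of
  \<open>E\<close>, if nonempty, is added as one more block.\<close>

lemma sum_norm_le_variation:
  assumes \<mu>: "\<mu> {} = 0" and I: "finite I" and E: "E \<in> sets borel"
    and B: "\<And>i. i \<in> I \<Longrightarrow> B i \<in> sets borel" "\<And>i. i \<in> I \<Longrightarrow> B i \<subseteq> E"
    and disj: "disjoint_family_on B I"
  shows "(\<Sum>i\<in>I. ennreal (norm (\<mu> (B i)))) \<le> variation \<mu> E"
proof -
  define J where "J = {i\<in>I. B i \<noteq> {}}"
  define Q where "Q = B ` J"
  define P where "P = Q \<union> ({E - \<Union>Q} - {{}})"
  have "inj_on B J"
    using disj by (force simp: inj_on_def J_def disjoint_family_on_def)
  then have "(\<Sum>C\<in>Q. ennreal (norm (\<mu> C))) = (\<Sum>i\<in>J. ennreal (norm (\<mu> (B i))))"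
    unfolding Q_def by (simp add: sum.reindex)
  moreover have "(\<Sum>i\<in>J. ennreal (norm (\<mu> (B i)))) = (\<Sum>i\<in>I. ennreal (norm (\<mu> (B i))))"
    using I by (intro sum.mono_neutral_left) (auto simp: J_def \<mu>)
  moreover have Q: "finite Q" "Q \<subseteq> sets borel" "\<Union>Q \<subseteq> E" "{} \<notin> Q"
    using I B by (auto simp: Q_def J_def)
  moreover have "disjoint_family_on B J"
    using disj by (rule disjoint_family_on_mono[rotated]) (auto simp: J_def)
  then have Q_disj: "disjoint Q" unfolding Q_def by (rule disjoint_family_on_disjoint_image)
  moreover have P: "finite P" "P \<subseteq> sets borel" "Q \<subseteq> P"
    using Q E by (auto simp: P_def sets.finite_Union)
  moreover have "disjoint P"
    using Q_disj unfolding P_def pairwise_def disjnt_def by blast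
  then have "partition_on E P"
    using Q by (auto simp: P_def partition_on_def)
  then have "(\<Sum>C\<in>P. ennreal (norm (\<mu> C))) \<le> variation \<mu> E"
    unfolding variation_def using P by (intro SUP_upper) auto
  moreover have "(\<Sum>C\<in>Q. ennreal (norm (\<mu> C))) \<le> (\<Sum>C\<in>P. ennreal (norm (\<mu> C)))"
    using P by (intro sum_mono2) auto
  ultimately show ?thesis by simp
qed

lemma variation_leI:
  assumes "\<And>P. finite P \<Longrightarrow> P \<subseteq> sets borel \<Longrightarrow> partition_on E P \<Longrightarrow>
    (\<Sum>B\<in>P. ennreal (norm (\<mu> B))) \<le> c"
  shows "variation \<mu> E \<le> c"
  unfolding variation_def by (rule SUP_least) (use assms in auto)

lemma variation_mono:
  assumes "\<mu> {} = 0" "F \<in> sets borel" "E \<subseteq> F"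
  shows "variation \<mu> E \<le> variation \<mu> F"
proof (rule variation_leI)
  fix P assume P: "finite P" "P \<subseteq> sets borel" "partition_on E P"
  have "disjoint_family_on (\<lambda>B. B) P"
    using partition_onD2[OF P(3)] by (auto simp: disjoint_family_on_def pairwise_def disjnt_def)
  then show "(\<Sum>B\<in>P. ennreal (norm (\<mu> B))) \<le> variation \<mu> F"
    using P partition_onD1[OF P(3)] assms
    by (intro sum_norm_le_variation[where B = "\<lambda>B. B"]) auto
qed

text \<open>Each block of a partition of the union is cut into its part in \<open>E\<close> and the
  rest, which lies in \<open>F\<close>.\<close>

lemma variation_Un_le:
  assumes \<mu>: "rcabv \<mu>" and E: "E \<in> sets borel" and F: "F \<in> sets borel"
  shows "variation \<mu> (E \<union> F) \<le> variation \<mu> E + variation \<mu> F"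
proof (rule variation_leI)
  fix P assume P: "finite P" "P \<subseteq> sets borel" "partition_on (E \<union> F) P"
  note disj = partition_onD2[OF P(3)] and cover = partition_onD1[OF P(3)]
  have split: "norm (\<mu> B) \<le> norm (\<mu> (B \<inter> E)) + norm (\<mu> (B - E))" if "B \<in> P" for B
  proof -
    have "\<mu> ((B \<inter> E) \<union> (B - E)) = \<mu> (B \<inter> E) + \<mu> (B - E)"
      using that P E by (intro rcabv_Un[OF \<mu>]) auto
    then show ?thesis by (simp add: Int_Diff_Un norm_triangle_ineq)
  qed
  have "(\<Sum>B\<in>P. ennreal (norm (\<mu> B))) \<le>
      (\<Sum>B\<in>P. ennreal (norm (\<mu> (B \<inter> E))) + ennreal (norm (\<mu> (B - E))))"
    by (intro sum_mono) (simp add: split flip: ennreal_plus)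
  also have "\<dots> = (\<Sum>B\<in>P. ennreal (norm (\<mu> (B \<inter> E)))) + (\<Sum>B\<in>P. ennreal (norm (\<mu> (B - E))))"
    by (rule sum.distrib)
  also have "\<dots> \<le> variation \<mu> E + variation \<mu> F"
    using P disj cover E F rcabv_empty[OF \<mu>]
    by (intro add_mono sum_norm_le_variation)
      (auto simp: disjoint_family_on_def pairwise_def disjnt_def)
  finally show "(\<Sum>B\<in>P. ennreal (norm (\<mu> B))) \<le> variation \<mu> E + variation \<mu> F" .
qed

text \<open>The deviation from the indicator is charged twice: \<open>d\<close> against the total
  variation, and the extra \<open>a\<close> only against the variation on \<open>E\<close>.\<close>

lemma simple_vm_integral_minus_indicator:
  fixes \<mu> :: "'k::topological_space set \<Rightarrow> 'x::real_normed_vector dual"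
  assumes \<mu>: "rcabv \<mu>" and s: "simple_function borel s" and A: "A \<in> sets borel"
    and E: "E \<in> sets borel" and d: "0 \<le> d" and a: "0 \<le> a" and e: "0 \<le> e"
    and close: "\<And>k. norm (s k - indicator A k *\<^sub>R x) \<le> d + indicator E k * a"
    and vE: "variation \<mu> E \<le> ennreal e"
  shows "\<bar>simple_vm_integral \<mu> s - \<mu> A x\<bar> \<le> d * enn2real (variation \<mu> UNIV) + e * a"
proof -
  \<comment> \<open>The atoms of the partition generated by \<open>s\<close>, \<open>A\<close> and \<open>E\<close> are the fibres of \<open>h\<close>.\<close>
  define h where "h k = (s k, k \<in> A, k \<in> E)" for k
  define D where "D z = h -` {z}" for z
  let ?R = "range h"
  have fin_s: "finite (range s)" using simple_functionD(1)[OF s] by simp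
  have fin: "finite ?R"
    by (rule finite_subset[of _ "range s \<times> UNIV"]) (use fin_s in \<open>auto simp: h_def\<close>)
  have D_borel: "D z \<in> sets borel" for z
  proof -
    have "s -` {fst z} \<in> sets borel" using simple_functionD(2)[OF s, of "{fst z}"] by simp
    moreover have "D z = s -` {fst z} \<inter> (if fst (snd z) then A else - A) \<inter>
        (if snd (snd z) then E else - E)"
      by (cases z) (auto simp: D_def h_def)
    ultimately show ?thesis using A E by auto
  qed
  have D_disj: "disjoint_family_on D J" for J
    by (auto simp: disjoint_family_on_def D_def)
  have \<mu>_UN: "\<mu> (\<Union>z\<in>J. D z) = (\<Sum>z\<in>J. \<mu> (D z))" if "J \<subseteq> ?R" for J
    using that fin by (intro rcabv_UN[OF \<mu>] D_borel D_disj) (auto intro: finite_subset)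
  have "simple_vm_integral \<mu> s = (\<Sum>v\<in>range s. \<Sum>z\<in>{z\<in>?R. fst z = v}. \<mu> (D z) (fst z))"
    unfolding simple_vm_integral_def
  proof (rule sum.cong[OF refl])
    fix v
    have "s -` {v} = (\<Union>z\<in>{z\<in>?R. fst z = v}. D z)" by (auto simp: D_def h_def)
    then have "\<mu> (s -` {v}) = (\<Sum>z\<in>{z\<in>?R. fst z = v}. \<mu> (D z))" by (simp only:) (rule \<mu>_UN, auto)
    then show "\<mu> (s -` {v}) v = (\<Sum>z\<in>{z\<in>?R. fst z = v}. \<mu> (D z) (fst z))"
      by (simp add: blinfun.sum_left)
  qed
  also have "\<dots> = (\<Sum>z\<in>?R. \<mu> (D z) (fst z))"
    by (rule sum.group) (use fin fin_s in \<open>auto simp: h_def\<close>)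
  finally have int_s: "simple_vm_integral \<mu> s = (\<Sum>z\<in>?R. \<mu> (D z) (fst z))" .
  have "A = (\<Union>z\<in>{z\<in>?R. fst (snd z)}. D z)" by (auto simp: D_def h_def)
  then have "\<mu> A = (\<Sum>z\<in>{z\<in>?R. fst (snd z)}. \<mu> (D z))" using \<mu>_UN[of "{z\<in>?R. fst (snd z)}"] by auto
  then have "\<mu> A x = (\<Sum>z\<in>{z\<in>?R. fst (snd z)}. \<mu> (D z) x)" by (simp add: blinfun.sum_left)
  also have "\<dots> = (\<Sum>z\<in>?R. if fst (snd z) then \<mu> (D z) x else 0)"
    using fin by (simp add: sum.inter_filter)
  also have "\<dots> = (\<Sum>z\<in>?R. \<mu> (D z) (of_bool (fst (snd z)) *\<^sub>R x))"
    by (intro sum.cong) auto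
  finally have diff: "simple_vm_integral \<mu> s - \<mu> A x =
      (\<Sum>z\<in>?R. \<mu> (D z) (fst z - of_bool (fst (snd z)) *\<^sub>R x))"
    by (simp add: int_s blinfun.diff_right sum_subtractf)
  let ?n = "\<lambda>z. norm (\<mu> (D z))"
  let ?R' = "{z\<in>?R. snd (snd z)}"
  have "\<bar>simple_vm_integral \<mu> s - \<mu> A x\<bar> \<le> (\<Sum>z\<in>?R. ?n z * (d + of_bool (snd (snd z)) * a))"
    unfolding diff
  proof (rule order_trans[OF sum_abs sum_mono])
    fix z assume "z \<in> ?R"
    \<comment> \<open>An index in the range of \<open>h\<close> has a nonempty fibre, so the
      pointwise bound can be read off at one of its points.\<close>
    then obtain k where k: "z = h k" by blast
    have "norm (fst z - of_bool (fst (snd z)) *\<^sub>R x) \<le> d + of_bool (snd (snd z)) * a"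
      using close[of k] by (simp add: k h_def indicator_def)
    then show "\<bar>\<mu> (D z) (fst z - of_bool (fst (snd z)) *\<^sub>R x)\<bar> \<le> ?n z * (d + of_bool (snd (snd z)) * a)"
      using norm_blinfun[of "\<mu> (D z)"] by (smt (verit) mult_left_mono norm_ge_zero real_norm_def)
  qed
  also have "\<dots> = d * (\<Sum>z\<in>?R. ?n z) + a * (\<Sum>z\<in>?R'. ?n z)"
  proof -
    have "(\<Sum>z\<in>?R'. ?n z) = (\<Sum>z\<in>?R. ?n z * of_bool (snd (snd z)))"
      unfolding sum.inter_filter[OF fin] by (intro sum.cong) auto
    then show ?thesis
      by (simp add: sum_distrib_left algebra_simps sum.distrib)
  qed
  also have "\<dots> \<le> d * enn2real (variation \<mu> UNIV) + a * e"
  proof (intro add_mono mult_left_mono)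
    have "ennreal (\<Sum>z\<in>?R. ?n z) \<le> variation \<mu> UNIV"
      using sum_norm_le_variation[where \<mu> = \<mu> and B = D and I = ?R and E = UNIV, OF rcabv_empty[OF \<mu>] fin]
        D_borel D_disj by simp
    \<comment> \<open>Finiteness matters for the passage to reals, since \<open>enn2real\<close>
      sends infinity to 0.\<close>
    moreover have "variation \<mu> UNIV < \<infinity>" using \<mu> by (simp add: rcabv_def)
    ultimately show "(\<Sum>z\<in>?R. ?n z) \<le> enn2real (variation \<mu> UNIV)"
      by (metis enn2real_ennreal enn2real_mono infinity_ennreal_def norm_ge_zero sum_nonneg)
    have "D z \<subseteq> E" if "z \<in> ?R'" for z
      using that by (auto simp: D_def h_def)
    then have "(\<Sum>z\<in>?R'. ennreal (?n z)) \<le> variation \<mu> E"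
      using fin by (intro sum_norm_le_variation rcabv_empty[OF \<mu>] E D_borel D_disj) auto
    then have "ennreal (\<Sum>z\<in>?R'. ?n z) \<le> variation \<mu> E" by simp
    then have "ennreal (\<Sum>z\<in>?R'. ?n z) \<le> ennreal e" using vE by (rule order_trans)
    then show "(\<Sum>z\<in>?R'. ?n z) \<le> e" using e by (simp add: ennreal_le_iff)
  qed (use d a in auto)
  finally show ?thesis by (simp add: mult.commute)
qed

text \<open>Off \<open>E\<close> the integrand equals the indicator times \<open>x\<close>, and on
  \<open>E\<close> it deviates by at most \<open>norm x\<close>. Simple functions uniformly within
  \<open>d\<close> of it add only \<open>d * V\<close> to the error, which is made smaller than any
  \<open>r\<close>.\<close>

lemma vm_integral_minus_indicator:
  fixes \<mu> :: "'k::topological_space set \<Rightarrow> 'x::real_normed_vector dual"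
  assumes \<mu>: "rcabv \<mu>" and int: "has_vm_integral \<mu> (\<lambda>k. f k *\<^sub>R x) I"
    and A: "A \<in> sets borel" and E: "E \<in> sets borel" and e: "0 \<le> e"
    and f: "\<And>k. f k \<in> {0..1}" "\<And>k. k \<notin> E \<Longrightarrow> f k = indicator A k"
    and vE: "variation \<mu> E \<le> ennreal e"
  shows "\<bar>I - \<mu> A x\<bar> \<le> e * norm x"
proof (rule field_le_epsilon)
  fix r :: real assume r: "0 < r"
  define V where "V = enn2real (variation \<mu> UNIV)"
  have V: "0 \<le> V" by (simp add: V_def)
  define d where "d = r / (V + 1)"
  have d: "0 < d" "d * V \<le> r" using r V by (simp_all add: d_def field_simps)
  obtain s where s: "\<And>n. simple_function borel (s n)"
    "uniform_limit UNIV s (\<lambda>k. f k *\<^sub>R x) sequentially"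
    "(\<lambda>n. simple_vm_integral \<mu> (s n)) \<longlonglongrightarrow> I"
    using int by (auto simp: has_vm_integral_def)
  have "\<bar>I - \<mu> A x\<bar> \<le> d * V + e * norm x"
  proof (rule tendsto_upperbound)
    show "(\<lambda>n. \<bar>simple_vm_integral \<mu> (s n) - \<mu> A x\<bar>) \<longlonglongrightarrow> \<bar>I - \<mu> A x\<bar>"
      by (intro tendsto_intros s)
    show "\<forall>\<^sub>F n in sequentially. \<bar>simple_vm_integral \<mu> (s n) - \<mu> A x\<bar> \<le> d * V + e * norm x"
      using uniform_limitD[OF s(2) d(1)]
    proof eventually_elim
      case (elim n)
      show ?case
        unfolding V_def
      proof (rule simple_vm_integral_minus_indicator[OF \<mu> s(1) A E])
        fix k
        have "norm (f k *\<^sub>R x - indicator A k *\<^sub>R x) = \<bar>f k - indicator A k\<bar> * norm x"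
          by (simp flip: scaleR_diff_left)
        also have "\<dots> \<le> indicator E k * norm x"
          using f(1)[of k] f(2)[of k] by (intro mult_right_mono) (auto simp: indicator_def)
        finally show "norm (s n k - indicator A k *\<^sub>R x) \<le> d + indicator E k * norm x"
          using elim norm_triangle_ineq[of "s n k - f k *\<^sub>R x" "f k *\<^sub>R x - indicator A k *\<^sub>R x"]
          by (auto simp: dist_norm intro: order_trans[OF _ add_mono[OF less_imp_le]])
      qed (use d e vE in auto)
    qed
  qed simp
  then show "\<bar>I - \<mu> A x\<bar> \<le> e * norm x + r" using d(2) by simp
qed

section \<open>Representing measures of strongly bounded operators\<close>

text \<open>Evaluating the second adjoint of \<open>T\<close> at an indicator and then at
  \<open>\<psi>\<close> is evaluating the indicator at \<open>\<psi> o\<^sub>L T\<close>. So on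
  Borel sets \<open>functional_measure \<psi> m\<close> is the measure of that functional, and
  values of \<open>\<psi>\<close> on the range of \<open>T\<close> become integrals.\<close>

lemma measure_of_functional_functional_measure:
  assumes "representing_measure m T"
  shows "measure_of_functional (functional_measure \<psi> m) (\<psi> o\<^sub>L T)"
proof -
  obtain ind where ind: "is_bidual_indicator ind"
    and m: "\<And>A x. A \<in> sets borel \<Longrightarrow> m A x = dual_map (dual_map T) (ind A x)"
    using assms by (auto simp: representing_measure_def)
  have dual: "dual_map T \<psi> = \<psi> o\<^sub>L T"
    by (rule blinfun_eqI) (simp add: dual_map_apply)
  obtain \<mu> where \<mu>: "measure_of_functional \<mu> (\<psi> o\<^sub>L T)"
    and eq: "\<And>A x. A \<in> sets borel \<Longrightarrow> ind A x (\<psi> o\<^sub>L T) = \<mu> A x"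
    using ind unfolding is_bidual_indicator_def by metis
  have agree: "functional_measure \<psi> m A = \<mu> A" if "A \<in> sets borel" for A
    by (rule blinfun_eqI) (simp add: functional_measure_apply m that dual_map_apply dual eq)
  have "rcabv (functional_measure \<psi> m) \<longleftrightarrow> rcabv \<mu>"
    "has_vm_integral (functional_measure \<psi> m) f I \<longleftrightarrow> has_vm_integral \<mu> f I" for f I
    by (rule rcabv_cong has_vm_integral_cong, erule agree)+
  then show ?thesis
    using \<mu> by (simp add: measure_of_functional_def)
qed

lemma variation_le_semivariation:
  "norm \<psi> \<le> 1 \<Longrightarrow> variation (functional_measure \<psi> m) E \<le> semivariation m E"
  unfolding semivariation_def by (rule SUP_upper) simp

lemma semivariation_mono:
  assumes "\<And>\<psi>. rcabv (functional_measure \<psi> m)" "F \<in> sets borel" "E \<subseteq> F"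
  shows "semivariation m E \<le> semivariation m F"
  unfolding semivariation_def
  by (intro SUP_mono') (use assms in \<open>auto intro: variation_mono rcabv_empty\<close>)

text \<open>If no compact subset of \<open>A\<close> exhausts it up to \<open>e\<close>, then regularity of the individual measures
  yields an increasing sequence of compact subsets whose successive differences have semivariation
  above \<open>e / 2\<close>. The tails of this sequence decrease to the empty set, against strong boundedness.\<close>

lemma strongly_bounded_inner_regular:
  fixes m :: "'k::t2_space set \<Rightarrow> 'x::real_normed_vector \<Rightarrow>\<^sub>L 'y::real_normed_vector bidual"
  assumes rc: "\<And>\<psi>. rcabv (functional_measure \<psi> m)" and sb: "strongly_bounded m"
    and A: "A \<in> sets borel" and e: "0 < e"
  obtains C where "compact C" "C \<subseteq> A" "semivariation m (A - C) \<le> ennreal e"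
proof (rule ccontr)
  assume "\<not> thesis"
  with that have big: "ennreal e < semivariation m (A - C)" if "compact C" "C \<subseteq> A" for C
    using that by (meson not_le)
  have borel: "C \<in> sets borel" if "compact C" for C :: "'k set"
    using that by (simp add: compact_imp_closed)
  have step: "\<exists>C'. (compact C' \<and> C' \<subseteq> A) \<and> (C \<subseteq> C' \<and> ennreal (e / 2) \<le> semivariation m (C' - C))"
    if C: "compact C" "C \<subseteq> A" for C
  proof -
    \<comment> \<open>A single measure from the unit ball already exceeds \<open>e\<close> on
      \<open>A - C\<close>. Its own regularity gives a compact \<open>D\<close> there that loses at
      most \<open>e / 2\<close>, so \<open>D\<close> carries at least \<open>e / 2\<close>.\<close>
    obtain \<psi> where \<psi>: "norm \<psi> \<le> 1" "ennreal e < variation (functional_measure \<psi> m) (A - C)"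
      using big[OF C] by (auto simp: semivariation_def less_SUP_iff)
    let ?\<mu> = "functional_measure \<psi> m"
    have AC: "A - C \<in> sets borel" using A borel[OF C(1)] by auto
    then obtain D U where D: "compact D" "open U" "D \<subseteq> A - C" "A - C \<subseteq> U"
      "variation ?\<mu> (U - D) < ennreal (e / 2)"
      using rc[of \<psi>] e unfolding rcabv_def by (meson half_gt_zero)
    have "variation ?\<mu> (A - C - D) \<le> variation ?\<mu> (U - D)"
      using D borel by (intro variation_mono rcabv_empty rc) auto
    then have rest: "variation ?\<mu> (A - C - D) \<le> ennreal (e / 2)" using D(5) by simp
    have "D \<union> (A - C - D) = A - C" using D(3) by blast
    then have "variation ?\<mu> (A - C) \<le> variation ?\<mu> D + variation ?\<mu> (A - C - D)"
      using variation_Un_le[OF rc[of \<psi>], of D "A - C - D"] AC borel[OF D(1)] by auto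
    then have "ennreal e < variation ?\<mu> D + ennreal (e / 2)"
      using \<psi>(2) rest by (meson add_left_mono less_le_trans order_trans)
    moreover have "ennreal e = ennreal (e / 2) + ennreal (e / 2)"
      using e by (simp flip: ennreal_plus)
    ultimately have "ennreal (e / 2) \<le> variation ?\<mu> D"
      by (metis add_right_mono linorder_le_cases not_le)
    also have "\<dots> \<le> semivariation m D" by (rule variation_le_semivariation) fact
    also have "D = (C \<union> D) - C" using D(3) by blast
    finally show ?thesis
      using C D by (intro exI[of _ "C \<union> D"]) auto
  qed
  obtain C where C: "\<And>n. compact (C n)" "\<And>n. C n \<subseteq> A" "\<And>n::nat. C n \<subseteq> C (Suc n)"
    "\<And>n. ennreal (e / 2) \<le> semivariation m (C (Suc n) - C n)"
    using dependent_nat_choice[of "\<lambda>_ C. compact C \<and> C \<subseteq> A"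
        "\<lambda>_ C C'. C \<subseteq> C' \<and> ennreal (e / 2) \<le> semivariation m (C' - C)"] step
    by (metis compact_empty empty_subsetI)
  \<comment> \<open>The tails are taken in the union of the \<open>C k\<close>, not in
    \<open>A\<close>, so that their intersection is empty; \<open>R n\<close> still contains
    \<open>C (Suc n) - C n\<close>.\<close>
  define R where "R n = (\<Union>k. C k) - C n" for n
  have "mono C" using C(3) by (rule incseq_SucI)
  then have "decseq R" by (auto simp: R_def decseq_def mono_def)
  moreover have R_borel: "R n \<in> sets borel" for n
    using borel[OF C(1)] by (auto simp: R_def)
  moreover have "(\<Inter>n. R n) = {}" by (auto simp: R_def)
  ultimately have "(\<lambda>n. semivariation m (R n)) \<longlonglongrightarrow> 0"
    using sb by (auto simp: strongly_bounded_def)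
  then have "\<forall>\<^sub>F n in sequentially. semivariation m (R n) < ennreal (e / 2)"
    using e by (intro order_tendstoD) auto
  then obtain n where "semivariation m (R n) < ennreal (e / 2)"
    by (auto simp: eventually_sequentially)
  moreover have "semivariation m (C (Suc n) - C n) \<le> semivariation m (R n)"
    by (intro semivariation_mono rc R_borel) (auto simp: R_def)
  ultimately show False using C(4)[of n] by simp
qed

section \<open>Urysohn functions and the operators that approximate the values of the
  measure\<close>

definition bcontfun_scaleR ::
  "('k::topological_space \<Rightarrow>\<^sub>C real) \<Rightarrow> 'x::real_normed_vector \<Rightarrow> ('k \<Rightarrow>\<^sub>C 'x)" where
  "bcontfun_scaleR f x = Bcontfun (\<lambda>k. f k *\<^sub>R x)"

lemma bcontfun_scaleR_apply: "bcontfun_scaleR f x k = f k *\<^sub>R x"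
proof -
  have "bounded ((\<lambda>r. r *\<^sub>R x) ` range f)"
    by (rule bounded_linear_image[OF bounded_apply_bcontfun bounded_linear_scaleR_left])
  then have "(\<lambda>k. f k *\<^sub>R x) \<in> bcontfun"
    by (auto simp: bcontfun_def image_image intro!: continuous_intros)
  then show ?thesis by (simp add: bcontfun_scaleR_def Bcontfun_inverse)
qed

lemma norm_bcontfun_scaleR_le: "norm (bcontfun_scaleR f x) \<le> norm x * norm f"
  by (rule norm_bound)
    (simp add: bcontfun_scaleR_apply mult.commute mult_left_mono norm_bounded flip: real_norm_def)

text \<open>The scalar function is fixed and the vector varies: this is the bounded map from X into
  C(K,X) along which \<open>T\<close> is pulled back to X.\<close>

lift_definition multiplication_operator ::
  "('k::topological_space \<Rightarrow>\<^sub>C real) \<Rightarrow> 'x::real_normed_vector \<Rightarrow>\<^sub>L ('k \<Rightarrow>\<^sub>C 'x)"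
  is bcontfun_scaleR
  by (rule bounded_linear_intro[OF _ _ norm_bcontfun_scaleR_le])
    (auto intro!: bcontfun_eqI simp: bcontfun_scaleR_apply algebra_simps)

lemma multiplication_operator_apply: "multiplication_operator f x k = f k *\<^sub>R x"
  by (simp add: multiplication_operator.rep_eq bcontfun_scaleR_apply)

lemma compact_Urysohn:
  fixes C D :: "'k::t2_space set"
  assumes cpt: "compact (UNIV :: 'k set)" and "closed C" "closed D" "C \<inter> D = {}"
  obtains f :: "'k \<Rightarrow>\<^sub>C real"
  where "\<And>k. f k \<in> {0..1}" "\<And>k. k \<in> C \<Longrightarrow> f k = 1" "\<And>k. k \<in> D \<Longrightarrow> f k = 0"
proof -
  have "Hausdorff_space (euclidean :: 'k topology)"
    unfolding Hausdorff_space_def using hausdorff by (auto simp: disjnt_def)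
  then have "normal_space (euclidean :: 'k topology)"
    using cpt by (intro compact_Hausdorff_or_regular_imp_normal_space) (simp_all add: compact_space_def)
  then obtain g where g: "continuous_map euclidean (top_of_set {0..1::real}) g"
    "g ` D \<subseteq> {0}" "g ` C \<subseteq> {1}"
    by (rule Urysohn_lemma[of _ D C 0 1]) (use assms in \<open>auto simp: disjnt_def\<close>)
  then have cont: "continuous_on UNIV g" and range: "\<And>k. g k \<in> {0..1}"
    by (auto simp: continuous_map_in_subtopology)
  have "bounded (range g)" by (rule bounded_subset[of "{0..1}"]) (use range in auto)
  with cont have "g \<in> bcontfun" by (simp add: bcontfun_def)
  then have "apply_bcontfun (Bcontfun g) = g" by (simp add: Bcontfun_inverse)
  with g range show thesis by (intro that[of "Bcontfun g"]) auto
qed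

text \<open>The function \<open>f\<close> differs from the indicator of \<open>A\<close> only on
  \<open>E\<close>, whose variation is at most \<open>e\<close> simultaneously for all
  \<open>\<psi>\<close> in the unit ball. This uniformity turns the scalar estimates into one in
  operator norm.\<close>

lemma representing_measure_approx:
  fixes T :: "('k::t2_space \<Rightarrow>\<^sub>C 'x::real_normed_vector) \<Rightarrow>\<^sub>L 'y::real_normed_vector"
  assumes cpt: "compact (UNIV :: 'k set)" and rep: "representing_measure m T"
    and sb: "strongly_bounded m" and A: "A \<in> sets borel" and e: "0 < e"
  obtains f where "norm ((canonical_embedding o\<^sub>L (T o\<^sub>L multiplication_operator f)) - m A) \<le> e"
proof -
  have mf: "measure_of_functional (functional_measure \<psi> m) (\<psi> o\<^sub>L T)" for \<psi>
    by (rule measure_of_functional_functional_measure[OF rep])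
  then have rc: "rcabv (functional_measure \<psi> m)" for \<psi> by (simp add: measure_of_functional_def)
  have e2: "0 < e / 2" using e by simp
  obtain C where C: "compact C" "C \<subseteq> A" "semivariation m (A - C) \<le> ennreal (e / 2)"
    using strongly_bounded_inner_regular[OF rc sb A e2] by blast
  \<comment> \<open>Inner regularity of the complement takes the place of outer regularity of
    \<open>A\<close>.\<close>
  have "- A \<in> sets borel" using A by simp
  then obtain D where D: "compact D" "D \<subseteq> - A" "semivariation m (- A - D) \<le> ennreal (e / 2)"
    using strongly_bounded_inner_regular[OF rc sb _ e2] by blast
  have closed: "closed C" "closed D" using C D by (simp_all add: compact_imp_closed)
  define E where "E = (A - C) \<union> (- A - D)"
  have E: "E \<in> sets borel" using A closed by (auto simp: E_def)
  obtain f :: "'k \<Rightarrow>\<^sub>C real" where f: "\<And>k. f k \<in> {0..1}" "\<And>k. k \<in> C \<Longrightarrow> f k = 1"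
    "\<And>k. k \<in> D \<Longrightarrow> f k = 0"
    using compact_Urysohn[OF cpt closed] C(2) D(2) by blast
  have f_off_E: "f k = indicator A k" if "k \<notin> E" for k
    using that f(2,3)[of k] C(2) D(2) by (cases "k \<in> A") (auto simp: E_def)
  let ?S = "T o\<^sub>L multiplication_operator f"
  have unit: "\<bar>\<psi> (?S x) - m A x \<psi>\<bar> \<le> e * norm x" if \<psi>: "norm \<psi> \<le> 1" for \<psi> :: "'y dual" and x
  proof -
    let ?\<mu> = "functional_measure \<psi> m"
    have "has_vm_integral ?\<mu> (apply_bcontfun (multiplication_operator f x)) (\<psi> (?S x))"
      using mf[of \<psi>] by (simp add: measure_of_functional_def)
    moreover have "apply_bcontfun (multiplication_operator f x) = (\<lambda>k. f k *\<^sub>R x)"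
      by (simp add: fun_eq_iff multiplication_operator_apply)
    ultimately have int: "has_vm_integral ?\<mu> (\<lambda>k. f k *\<^sub>R x) (\<psi> (?S x))" by simp
    have "variation ?\<mu> E \<le> variation ?\<mu> (A - C) + variation ?\<mu> (- A - D)"
      unfolding E_def using A closed by (intro variation_Un_le rc) auto
    also have "\<dots> \<le> ennreal (e / 2) + ennreal (e / 2)"
      by (intro add_mono order_trans[OF variation_le_semivariation[OF \<psi>]] C D)
    also have "\<dots> = ennreal e" using e by (simp flip: ennreal_plus)
    finally show ?thesis
      using vm_integral_minus_indicator[OF rc int A E _ f(1) f_off_E] e
      by (simp add: functional_measure_apply)
  qed
  have bound: "\<bar>\<psi> (?S x) - m A x \<psi>\<bar> \<le> e * norm x * norm \<psi>" for \<psi> :: "'y dual" and x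
  proof (cases "\<psi> = 0")
    case False
    have "\<bar>inverse (norm \<psi>) * (\<psi> (?S x) - m A x \<psi>)\<bar> \<le> e * norm x"
      using unit[of "inverse (norm \<psi>) *\<^sub>R \<psi>" x] False
      by (simp add: blinfun.scaleR_left blinfun.scaleR_right right_diff_distrib)
    then show ?thesis using False by (simp add: abs_mult field_simps)
  qed (simp add: blinfun.zero_left blinfun.zero_right)
  show thesis
  proof (rule that, rule norm_blinfun_bound)
    fix x
    show "norm (((canonical_embedding o\<^sub>L ?S) - m A) x) \<le> e * norm x"
      by (rule norm_blinfun_bound)
        (use bound[of _ x] e in \<open>auto simp: blinfun.diff_left canonical_embedding_apply\<close>)
  qed (use e in simp)
qed

text \<open>Composition with the embedding preserves operator norms, so approximants
  \<open>S n\<close> with errors \<open>1 / (n + 1)\<close> form a Cauchy sequence. Completeness of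
  the codomain gives a limit, and uniqueness of limits identifies its embedded image with
  \<open>L\<close>.\<close>

lemma canonical_embedding_range_closed:
  fixes L :: "'x::real_normed_vector \<Rightarrow>\<^sub>L 'y::banach bidual"
  assumes approx: "\<And>e. 0 < e \<Longrightarrow> \<exists>S. norm ((canonical_embedding o\<^sub>L S) - L) \<le> e"
  obtains S where "L = canonical_embedding o\<^sub>L S"
proof -
  have diff: "(canonical_embedding o\<^sub>L S) - (canonical_embedding o\<^sub>L R) = canonical_embedding o\<^sub>L (S - R)"
    for S R :: "'x \<Rightarrow>\<^sub>L 'y"
    by (rule blinfun_eqI) (simp add: blinfun.diff_left blinfun.diff_right)
  obtain S where S: "\<And>n. norm ((canonical_embedding o\<^sub>L S n) - L) \<le> inverse (real (Suc n))"
    using approx[of "inverse (real (Suc n))" for n]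
    by (metis inverse_positive_iff_positive of_nat_0_less_iff zero_less_Suc)
  have "(\<lambda>n. (canonical_embedding o\<^sub>L S n) - L) \<longlonglongrightarrow> 0"
    by (rule tendsto_norm_zero_cancel, rule Lim_null_comparison[OF _ LIMSEQ_inverse_real_of_nat])
      (use S in simp)
  then have lim: "(\<lambda>n. canonical_embedding o\<^sub>L S n) \<longlonglongrightarrow> L" by (simp add: LIM_zero_iff)
  have "dist (S i) (S j) = dist (canonical_embedding o\<^sub>L S i) (canonical_embedding o\<^sub>L S j)" for i j
    by (simp add: dist_norm diff norm_canonical_embedding_compose)
  then have "Cauchy S" using LIMSEQ_imp_Cauchy[OF lim] by (simp add: Cauchy_def)
  then obtain R where R: "S \<longlonglongrightarrow> R" by (auto simp: Cauchy_convergent_iff convergent_def)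
  then have "(\<lambda>n. canonical_embedding o\<^sub>L S n) \<longlonglongrightarrow> (canonical_embedding o\<^sub>L R)"
    by (intro tendsto_intros bounded_bilinear.tendsto[OF bounded_bilinear_blinfun_compose])
  with lim show thesis by (intro that LIMSEQ_unique)
qed

theorem corollary4:
  fixes p :: real
    and T :: "('k::t2_space \<Rightarrow>\<^sub>C 'x::banach) \<Rightarrow>\<^sub>L 'y::banach"
    and m :: "'k set \<Rightarrow> 'x \<Rightarrow>\<^sub>L 'y bidual"
  assumes "1 \<le> p"
    and "compact (UNIV :: 'k set)"
    and "representing_measure m T"
    and "strongly_bounded m"
  shows "\<forall>A\<in>sets borel. \<exists>S :: 'x \<Rightarrow>\<^sub>L 'y.
           m A = canonical_embedding o\<^sub>L S \<and>
           (weak_Dunford_Pettis T \<longrightarrow> weak_Dunford_Pettis S) \<and>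
           (weak_star_Dunford_Pettis T \<longrightarrow> weak_star_Dunford_Pettis S) \<and>
           (weak_p_convergent p T \<longrightarrow> weak_p_convergent p S) \<and>
           (weak_star_p_convergent p T \<longrightarrow> weak_star_p_convergent p S)"
proof
  fix A :: "'k set" assume A: "A \<in> sets borel"
  have approx: "\<exists>f. norm ((canonical_embedding o\<^sub>L (T o\<^sub>L multiplication_operator f)) - m A) \<le> e"
    if "0 < e" for e
    using representing_measure_approx[OF assms(2-4) A that] by blast
  then obtain S where S: "m A = canonical_embedding o\<^sub>L S"
    using canonical_embedding_range_closed[of "m A"] by metis
  \<comment> \<open>By isometry, the approximation in the bidual is an approximation of
    \<open>S\<close> itself.\<close>
  have near: "\<exists>f. norm (S - (T o\<^sub>L multiplication_operator f)) \<le> e" if "0 < e" for e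
  proof -
    have "(canonical_embedding o\<^sub>L R) - m A = canonical_embedding o\<^sub>L (R - S)" for R :: "'x \<Rightarrow>\<^sub>L 'y"
      unfolding S by (rule blinfun_eqI) (simp add: blinfun.diff_left blinfun.diff_right)
    with approx[OF that] show ?thesis
      by (simp add: norm_canonical_embedding_compose norm_minus_commute)
  qed
  \<comment> \<open>One statement serves all four properties: each hypothesis on the sequences
    implies weakly null vectors and weak* null functionals, which give the norm bounds. Only the
    convergence along \<open>T\<close> depends on the property, and it comes from applying that
    property to the images under \<open>multiplication_operator f\<close>.\<close>
  have transfer: "(\<lambda>n. \<psi> n (S (x n))) \<longlonglongrightarrow> 0"
    if x: "weakly_null x" and \<psi>: "weak_star_null \<psi>"
      and T: "\<And>f. (\<lambda>n. \<psi> n (T (multiplication_operator f (x n)))) \<longlonglongrightarrow> 0"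
    for x :: "nat \<Rightarrow> 'x" and \<psi> :: "nat \<Rightarrow> 'y dual"
  proof -
    obtain B where B: "\<And>n. norm (x n) \<le> B" using weakly_null_bounded[OF x] by blast
    obtain C where C: "\<And>n. norm (\<psi> n) \<le> C" using weak_star_null_bounded[OF \<psi>] by blast
    have "\<exists>R. norm (S - R) \<le> e \<and> (\<lambda>n. \<psi> n (R (x n))) \<longlonglongrightarrow> 0" if e: "0 < e" for e
    proof -
      obtain f where "norm (S - (T o\<^sub>L multiplication_operator f)) \<le> e" using near[OF e] by blast
      with T[of f] show ?thesis by (intro exI[of _ "T o\<^sub>L multiplication_operator f"]) simp
    qed
    then show ?thesis by (rule pairing_tendsto_zero_closed[OF B C])
  qed
  have p: "0 < p" using assms(1) by simp
  show "\<exists>S :: 'x \<Rightarrow>\<^sub>L 'y.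
           m A = canonical_embedding o\<^sub>L S \<and>
           (weak_Dunford_Pettis T \<longrightarrow> weak_Dunford_Pettis S) \<and>
           (weak_star_Dunford_Pettis T \<longrightarrow> weak_star_Dunford_Pettis S) \<and>
           (weak_p_convergent p T \<longrightarrow> weak_p_convergent p S) \<and>
           (weak_star_p_convergent p T \<longrightarrow> weak_star_p_convergent p S)"
  proof (intro exI[of _ S] conjI impI S)
    assume "weak_Dunford_Pettis T"
    then show "weak_Dunford_Pettis S"
      unfolding weak_Dunford_Pettis_def
      by (blast intro: transfer weakly_null_blinfun weakly_null_imp_weak_star_null)
  next
    assume "weak_star_Dunford_Pettis T"
    then show "weak_star_Dunford_Pettis S"
      unfolding weak_star_Dunford_Pettis_def
      by (blast intro: transfer weakly_null_blinfun)
  next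
    assume "weak_p_convergent p T"
    then show "weak_p_convergent p S"
      unfolding weak_p_convergent_def
      by (blast intro: transfer weakly_p_summable_blinfun weakly_null_imp_weak_star_null
          weakly_p_summable_imp_weakly_null[OF p])
  next
    assume "weak_star_p_convergent p T"
    then show "weak_star_p_convergent p S"
      unfolding weak_star_p_convergent_def
      by (blast intro: transfer weakly_p_summable_blinfun weakly_p_summable_imp_weakly_null[OF p])
  qed
qed

end
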